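(* The generalized BCH families $F_7$, $F_{11}$ and $F_{13}$ are all of unit rate.
   Context: Generalized BCH family: for a fixed odd integer $n>1$ and integers $m\ge1$ with $n\le q-1$, where $q=2^m$, let $S_{n,m}=\{(a,a^n)\mid a\in\mathbb{F}_q\}\subseteq\mathbb{F}_q^2$ and let $\Gamma_{n,m}=\mathrm{Cay}(\mathbb{F}_q^2,S_{n,m}\setminus\{0\})$ be the graph with vertex set $\mathbb{F}_q^2$ in which $x,y$ are adjacent iff $x-y\in S_{n,m}\setminus\{0\}$. Let $C_{n,m}$ be the binary linear code with parity-check matrix $A(\Gamma_{n,m})+I$ over $\mathbb{F}_2$, where $A(\Gamma_{n,m})$ is the adjacency matrix. The family $F_n$ is $\{C_{n,m}\}_m$. The rate of a binary linear code is its dimension divided by its length, and a family is of unit rate if the rates of its codes converge to $1$ as $m\to\infty$. *)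

theory Defs
  imports
    Complex_Main
    "HOL-Library.Z2"
    "HOL-Library.Function_Algebras"
    "HOL-Algebra.Ring"
    "HOL-Algebra.Coset"
    "Graph_Theory.Pair_Digraph"
begin

section \<open>Cayley graphs and adjacency matrices\<close>

text \<open>The operation of \<open>G\<close> is written multiplicatively, so \<open>x \<otimes> inv y\<close> is
  the difference \<open>x - y\<close> when \<open>G\<close> is the additive group of a vector space. An undirected
  graph is a symmetric digraph, as in the locale \<^locale>\<open>pair_graph\<close>.\<close>

definition cayley_graph :: "('v, 'c) monoid_scheme \<Rightarrow> 'v set \<Rightarrow> 'v pair_pre_digraph" where
  "cayley_graph G S =
     \<lparr> pverts = carrier G,
       parcs = {(x, y). x \<in> carrier G \<and> y \<in> carrier G \<and> x \<otimes>\<^bsub>G\<^esub> inv\<^bsub>G\<^esub> y \<in> S} \<rparr>"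

definition adjacency_matrix :: "'v pair_pre_digraph \<Rightarrow> 'v \<Rightarrow> 'v \<Rightarrow> bit" where
  "adjacency_matrix \<Gamma> x y = (if (x, y) \<in> parcs \<Gamma> then 1 else 0)"

definition identity_matrix :: "'v \<Rightarrow> 'v \<Rightarrow> bit" where
  "identity_matrix x y = (if x = y then 1 else 0)"

lemma pair_graph_cayley_graph:
  assumes "group G" "finite (carrier G)" "\<one>\<^bsub>G\<^esub> \<notin> S"
    and "\<And>s. s \<in> S \<Longrightarrow> s \<in> carrier G \<Longrightarrow> inv\<^bsub>G\<^esub> s \<in> S"
  shows "pair_graph (cayley_graph G S)"
proof -
  interpret group G by fact
  have "symmetric (with_proj (cayley_graph G S))"
    unfolding symmetric_def
  proof (rule symI)
    fix x y
    assume "(x, y) \<in> arcs_ends (with_proj (cayley_graph G S))"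
    then have xy: "x \<in> carrier G" "y \<in> carrier G" and s: "x \<otimes>\<^bsub>G\<^esub> inv\<^bsub>G\<^esub> y \<in> S"
      by (auto simp: cayley_graph_def)
    from assms(4)[OF s] xy have "y \<otimes>\<^bsub>G\<^esub> inv\<^bsub>G\<^esub> x \<in> S"
      by (simp add: inv_mult_group)
    with xy show "(y, x) \<in> arcs_ends (with_proj (cayley_graph G S))"
      by (auto simp: cayley_graph_def)
  qed
  moreover have "finite (parcs (cayley_graph G S))"
    by (rule finite_subset[of _ "carrier G \<times> carrier G"])
       (auto simp: cayley_graph_def assms(2))
  ultimately show ?thesis
    using assms(2,3) by unfold_locales (auto simp: cayley_graph_def)
qed


section \<open>Binary linear codes\<close>

text \<open>A binary code is given by its finite set of coordinates together with its set of words.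
  Words over the coordinates \<open>V\<close> are functions to the two-element field \<^typ>\<open>bit\<close> that vanish outside \<open>V\<close>,
  so that they are determined by their values on \<open>V\<close>.\<close>

type_synonym 'v binary_code = "'v set \<times> ('v \<Rightarrow> bit) set"

definition scale_word :: "bit \<Rightarrow> ('v \<Rightarrow> bit) \<Rightarrow> 'v \<Rightarrow> bit" where
  "scale_word a c = (\<lambda>v. a * c v)"

lemma vector_space_scale_word: "vector_space scale_word"
  by standard (auto simp: scale_word_def fun_eq_iff algebra_simps)

definition parity_check_code ::
    "'r set \<Rightarrow> 'v set \<Rightarrow> ('r \<Rightarrow> 'v \<Rightarrow> bit) \<Rightarrow> 'v binary_code" where
  "parity_check_code R V H =
     (V, {c. (\<forall>v. v \<notin> V \<longrightarrow> c v = 0) \<and> (\<forall>r\<in>R. (\<Sum>v\<in>V. H r v * c v) = 0)})"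

lemma subspace_parity_check_code:
  "module.subspace scale_word (snd (parity_check_code R V H))"
proof -
  interpret vector_space scale_word by (rule vector_space_scale_word)
  have add: "(\<Sum>v\<in>V. H r v * (c v + d v)) = (\<Sum>v\<in>V. H r v * c v) + (\<Sum>v\<in>V. H r v * d v)"
    for r and c d :: "_ \<Rightarrow> bit"
    by (simp only: distrib_left sum.distrib)
  have scale: "(\<Sum>v\<in>V. H r v * scale_word a c v) = a * (\<Sum>v\<in>V. H r v * c v)" for r a c
    by (simp only: scale_word_def mult.left_commute sum_distrib_left)
  show ?thesis
    by (rule subspaceI) (simp_all add: parity_check_code_def add scale del: mult_bit_eq_and add_bit_eq_xor,
         simp_all add: scale_word_def)
qed

definition code_length :: "'v binary_code \<Rightarrow> nat" where
  "code_length C = card (fst C)"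

definition code_dim :: "'v binary_code \<Rightarrow> nat" where
  "code_dim C = vector_space.dim scale_word (snd C)"

definition code_rate :: "'v binary_code \<Rightarrow> real" where
  "code_rate C = real (code_dim C) / real (code_length C)"

text \<open>A family of codes is indexed by a set \<open>I\<close> of naturals (in practice cofinite); its values
  outside \<open>I\<close> are irrelevant.\<close>

definition unit_rate :: "nat set \<Rightarrow> (nat \<Rightarrow> 'v binary_code) \<Rightarrow> bool" where
  "unit_rate I F \<longleftrightarrow> ((\<lambda>m. code_rate (F m)) \<longlongrightarrow> 1) (inf sequentially (principal I))"


section \<open>Generalized BCH codes\<close>

abbreviation plane :: "('a, 'c) ring_scheme \<Rightarrow> ('a \<times> 'a) monoid" where
  "plane K \<equiv> add_monoid K \<times>\<times> add_monoid K"

definition power_curve :: "nat \<Rightarrow> ('a, 'c) ring_scheme \<Rightarrow> ('a \<times> 'a) set" where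
  "power_curve n K = {(a, a [^]\<^bsub>K\<^esub> n) | a. a \<in> carrier K}"

definition gen_BCH_graph :: "nat \<Rightarrow> ('a, 'c) ring_scheme \<Rightarrow> ('a \<times> 'a) pair_pre_digraph" where
  "gen_BCH_graph n K = cayley_graph (plane K) (power_curve n K - {(\<zero>\<^bsub>K\<^esub>, \<zero>\<^bsub>K\<^esub>)})"

definition gen_BCH_code :: "nat \<Rightarrow> ('a, 'c) ring_scheme \<Rightarrow> ('a \<times> 'a) binary_code" where
  "gen_BCH_code n K =
     (let \<Gamma> = gen_BCH_graph n K
      in parity_check_code (pverts \<Gamma>) (pverts \<Gamma>)
           (\<lambda>x y. adjacency_matrix \<Gamma> x y + identity_matrix x y))"

definition gen_BCH_index :: "nat \<Rightarrow> nat set" where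
  "gen_BCH_index n = {m. 1 \<le> m \<and> n \<le> 2 ^ m - 1}"

text \<open>The family \<open>F\<^sub>n\<close> for a choice \<open>K m\<close> of the field with \<open>2\<^sup>m\<close> elements.\<close>

definition gen_BCH_family ::
    "nat \<Rightarrow> (nat \<Rightarrow> ('a, 'c) ring_scheme) \<Rightarrow> nat \<Rightarrow> ('a \<times> 'a) binary_code" where
  "gen_BCH_family n K = (\<lambda>m. gen_BCH_code n (K m))"

end

theory Submission
  imports Defs "HOL-Algebra.Multiplicative_Group"
begin

text \<open>The argument works for every \<open>n > 0\<close>. In \<open>F\<^sub>2\<close>-coordinates the matrix
  \<open>A + I\<close> has the entries \<open>f (x + y)\<close>, where the indicator \<open>f\<close> of the curve
  \<open>v = u\<^sup>n\<close> is the polynomial \<open>\<Prod>\<^sub>k (1 + v\<^sub>k + (u\<^sup>n)\<^sub>k)\<close>. Each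
  \<open>(u\<^sup>n)\<^sub>k\<close> has degree at most \<open>n\<close>, and all functions of \<open>u\<close> have degree at most
  \<open>m\<close>, so \<open>f\<close> has degree at most \<open>2m - m/n\<close>. The Croot--Lev--Pach splitting then
  bounds the rank of the matrix by twice the number of squarefree monomials of degree at most
  \<open>m - m/(2n)\<close> in \<open>2m\<close> variables, which by Chebyshev's inequality is a fraction
  \<open>O(1/m)\<close> of all \<open>4\<^sup>m\<close> monomials.\<close>

section \<open>Dimension bounds for binary codes\<close>

text \<open>Arithmetic on \<open>bit\<close> stays in ring form, so that distributivity and the
  \<open>sum\<close> and \<open>prod\<close> lemmas apply.\<close>

declare add_bit_eq_xor [simp del] mult_bit_eq_and [simp del]

lemma bit_add_self [simp]: "x + x = 0" for x :: bit
  by (cases x) auto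

definition words :: "'v set \<Rightarrow> ('v \<Rightarrow> bit) set" where
  "words V = {c. \<forall>v. v \<notin> V \<longrightarrow> c v = 0}"

lemma bij_betw_words_Pow: "bij_betw (\<lambda>c. {v. c v = 1}) (words V) (Pow V)"
proof (rule bij_betw_byWitness[where f' = "\<lambda>A v. if v \<in> A then 1 else 0"])
  show "\<forall>c\<in>words V. (\<lambda>v. if v \<in> {v. c v = 1} then 1 else 0) = c"
    by (auto simp: fun_eq_iff)
  show "\<forall>A\<in>Pow V. {v. (if v \<in> A then 1 else 0 :: bit) = 1} = A"
    by (auto split: if_splits)
  show "(\<lambda>c. {v. c v = 1}) ` words V \<subseteq> Pow V"
    by (auto simp: words_def)
  show "(\<lambda>A v. if v \<in> A then 1 else 0) ` Pow V \<subseteq> words V"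
    by (auto simp: words_def)
qed

lemma finite_words: "finite V \<Longrightarrow> finite (words V)"
  using bij_betw_finite[OF bij_betw_words_Pow] by blast

lemma card_words: "finite V \<Longrightarrow> card (words V) = 2 ^ card V"
  using bij_betw_same_card[OF bij_betw_words_Pow] by (metis card_Pow)

interpretation words: vector_space scale_word
  by (rule vector_space_scale_word)

lemma scale_word_bit: "scale_word a c = (if a = 1 then c else 0)"
  by (cases a) (auto simp: scale_word_def fun_eq_iff)

lemma subspace_words: "words.subspace (words V)"
  by (rule words.subspaceI) (auto simp: words_def scale_word_def)

text \<open>The unit vectors \<open>delta v\<close> form a basis. A new one is independent of the
  old ones because their span stays inside \<open>words V\<close>.\<close>

lemma dim_words:
  assumes "finite V"
  shows "words.dim (words V) = card V"
proof -
  define delta :: "'a \<Rightarrow> 'a \<Rightarrow> bit" where "delta = (\<lambda>v w. if w = v then 1 else 0)"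
  have inj: "inj_on delta A" for A
    by (auto simp: inj_on_def delta_def fun_eq_iff split: if_splits)
  have "words.independent (delta ` V) \<and> words V \<subseteq> words.span (delta ` V)"
    using assms
  proof induction
    case empty
    then show ?case by (auto simp: words_def words.independent_empty fun_eq_iff)
  next
    case (insert x V)
    have "words.span (delta ` V) \<subseteq> words V"
      by (rule words.span_minimal[OF _ subspace_words]) (auto simp: delta_def words_def)
    moreover have "delta x \<notin> words V"
      using insert.hyps by (auto simp: words_def delta_def intro!: exI[of _ x])
    ultimately have "words.independent (insert (delta x) (delta ` V))"
      using insert.IH words.independent_insertI by blast
    moreover have "c \<in> words.span (insert (delta x) (delta ` V))" if c: "c \<in> words (insert x V)" for c
    proof -
      have "c - scale_word (c x) (delta x) \<in> words V"
        using c by (auto simp: words_def delta_def scale_word_def)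
      then show ?thesis
        using insert.IH by (auto simp: words.span_insert)
    qed
    ultimately show ?case by auto
  qed
  moreover have "delta ` V \<subseteq> words V"
    by (auto simp: words_def delta_def)
  ultimately show ?thesis
    using words.dim_unique[of "delta ` V" "words V"] card_image[OF inj] by blast
qed

lemma dim_subset_words:
  assumes "finite V" "W \<subseteq> words V"
  shows "words.dim W \<le> card V"
proof -
  obtain B where B: "B \<subseteq> words V" "words V \<subseteq> words.span B" "card B = words.dim (words V)"
    by (rule words.basis_exists)
  then have "words.dim W \<le> card B"
    using assms finite_subset[OF B(1) finite_words] by (intro words.dim_le_card) auto
  then show ?thesis
    by (simp add: B(3) dim_words assms(1))
qed

text \<open>One linear equation costs at most one dimension: if \<open>\<phi> w = 1\<close>, any
  element outside the kernel is a kernel element plus \<open>w\<close>. Additivity is full linearity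
  here, since the only scalars are 0 and 1.\<close>

lemma dim_le_dim_kernel:
  assumes W: "words.subspace W" "finite W"
    and add: "\<And>c d. \<phi> (c + d) = \<phi> c + (\<phi> d :: bit)"
  shows "words.dim W \<le> words.dim {c \<in> W. \<phi> c = 0} + 1"
proof -
  obtain B where B: "B \<subseteq> {c \<in> W. \<phi> c = 0}" "{c \<in> W. \<phi> c = 0} \<subseteq> words.span B"
      "card B = words.dim {c \<in> W. \<phi> c = 0}"
    by (rule words.basis_exists)
  have "finite B"
    using finite_subset[OF B(1)] W(2) by simp
  have "\<exists>w. W \<subseteq> words.span (insert w B)"
  proof (cases "\<exists>w\<in>W. \<phi> w = 1")
    case True
    then obtain w where w: "w \<in> W" "\<phi> w = 1" by blast
    have "c \<in> words.span (insert w B)" if c: "c \<in> W" for c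
    proof (cases "\<phi> c = 0")
      case True
      then have "c \<in> words.span B" using B(2) c by auto
      then show ?thesis using words.span_mono[of B "insert w B"] by auto
    next
      case False
      then have "\<phi> (c + w) = 0"
        using w(2) by (simp add: add)
      then have "c + w \<in> words.span B"
        using B(2) words.subspace_add[OF W(1) c w(1)] by blast
      then have "(c + w) + w \<in> words.span (insert w B)"
        by (rule words.span_add[OF subsetD[OF words.span_mono[OF subset_insertI]]
              words.span_base[OF insertI1]])
      moreover have "(c + w) + w = c"
        by (simp add: fun_eq_iff add.assoc)
      ultimately show ?thesis by simp
    qed
    then show ?thesis by blast
  next
    case False
    then have "W \<subseteq> {c \<in> W. \<phi> c = 0}" by auto
    then have "W \<subseteq> words.span B" using B(2) by (rule order_trans)
    \<comment> \<open>The kernel is all of \<open>W\<close>, and \<open>0\<close> is a dummy for the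
      extra vector.\<close>
    then show ?thesis using words.span_mono[of B "insert 0 B"] by blast
  qed
  then obtain w where "W \<subseteq> words.span (insert w B)" ..
  then have "words.dim W \<le> card (insert w B)"
    using \<open>finite B\<close> by (intro words.dim_le_card) auto
  also have "\<dots> \<le> card B + 1"
    using \<open>finite B\<close> by (simp add: card_insert_if)
  finally show ?thesis by (simp add: B(3))
qed

lemma dim_le_dim_kernels:
  assumes "finite A" and W: "words.subspace W" "finite W"
    and add: "\<And>i c d. \<phi> i (c + d) = \<phi> i c + (\<phi> i d :: bit)"
  shows "words.dim W \<le> words.dim {c \<in> W. \<forall>i\<in>A. \<phi> i c = 0} + card A"
  using assms(1)
proof induction
  case (insert i A)
  let ?K = "\<lambda>A. {c \<in> W. \<forall>i\<in>A. \<phi> i c = 0}"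
  have zero: "\<phi> i 0 = 0" for i
    using add[of i 0 0] by simp
  have "words.subspace (?K A)"
  proof (rule words.subspaceI)
    show "0 \<in> ?K A" using words.subspace_0[OF W(1)] by (simp add: zero)
    show "c + d \<in> ?K A" if "c \<in> ?K A" "d \<in> ?K A" for c d
      using that words.subspace_add[OF W(1), of c d] by (simp add: add)
    show "scale_word a c \<in> ?K A" if "c \<in> ?K A" for a c
      using that words.subspace_0[OF W(1)] by (simp add: scale_word_bit zero)
  qed
  then have "words.dim (?K A) \<le> words.dim {c \<in> ?K A. \<phi> i c = 0} + 1"
    by (rule dim_le_dim_kernel) (use W(2) in \<open>simp_all add: add\<close>)
  also have "{c \<in> ?K A. \<phi> i c = 0} = ?K (insert i A)" by auto
  finally have "words.dim (?K A) \<le> words.dim (?K (insert i A)) + 1" .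
  moreover have "card (insert i A) = card A + 1"
    using insert.hyps by simp
  ultimately show ?case
    using insert.IH by linarith
qed simp

text \<open>The hypothesis writes \<open>H\<close> as a sum of \<open>card A\<close> matrices of
  rank at most one. A word orthogonal to every row \<open>h i\<close> is killed by \<open>H\<close>,
  and these \<open>card A\<close> equations cost at most \<open>card A\<close> dimensions.\<close>

lemma card_le_code_dim_parity_check_code:
  assumes fin: "finite V" "finite A"
    and H: "\<And>r v. r \<in> R \<Longrightarrow> v \<in> V \<Longrightarrow> H r v = (\<Sum>i\<in>A. g i r * h i v)"
  shows "card V \<le> code_dim (parity_check_code R V H) + card A"
proof -
  let ?\<phi> = "\<lambda>i c. \<Sum>v\<in>V. h i v * c v"
  let ?K = "{c \<in> words V. \<forall>i\<in>A. ?\<phi> i c = 0}"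
  have "card V \<le> words.dim ?K + card A"
    using dim_le_dim_kernels[OF fin(2) subspace_words finite_words[OF fin(1)], of ?\<phi>]
    by (simp add: dim_words fin(1) plus_fun_def distrib_left sum.distrib)
  moreover have "words.dim ?K \<le> code_dim (parity_check_code R V H)"
  proof -
    have sub: "?K \<subseteq> snd (parity_check_code R V H)"
    proof
      fix c assume c: "c \<in> ?K"
      have "(\<Sum>v\<in>V. H r v * c v) = 0" if "r \<in> R" for r
      proof -
        have "(\<Sum>v\<in>V. H r v * c v) = (\<Sum>v\<in>V. \<Sum>i\<in>A. g i r * (h i v * c v))"
          by (intro sum.cong) (simp_all add: H that sum_distrib_right mult.assoc)
        also have "\<dots> = (\<Sum>i\<in>A. g i r * ?\<phi> i c)"
          by (subst sum.swap) (simp add: sum_distrib_left)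
        also have "\<dots> = 0" using c by simp
        finally show ?thesis .
      qed
      then show "c \<in> snd (parity_check_code R V H)"
        using c by (auto simp: parity_check_code_def words_def)
    qed
    let ?C = "snd (parity_check_code R V H)"
    have "?C \<subseteq> words V" by (auto simp: parity_check_code_def words_def)
    then have "finite ?C" using finite_words[OF fin(1)] finite_subset by blast
    obtain B where B: "B \<subseteq> ?C" "?C \<subseteq> words.span B" "card B = words.dim ?C"
      by (rule words.basis_exists)
    have "words.dim ?K \<le> card B"
      using order_trans[OF sub B(2)] finite_subset[OF B(1) \<open>finite ?C\<close>] by (rule words.dim_le_card)
    then show ?thesis by (simp add: B(3) code_dim_def)
  qed
  ultimately show ?thesis by simp
qed

lemma code_length_parity_check_code: "code_length (parity_check_code R V H) = card V"
  by (simp add: code_length_def parity_check_code_def)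

lemma code_dim_parity_check_code_le:
  assumes "finite V"
  shows "code_dim (parity_check_code R V H) \<le> card V"
  unfolding code_dim_def
  by (rule dim_subset_words[OF assms]) (auto simp: parity_check_code_def words_def)


section \<open>Boolean polynomials\<close>

text \<open>The functions given by F_2-polynomials of degree at most \<open>d\<close> in the
  variables \<open>I\<close>. Squarefree monomials, indexed by sets \<open>T\<close>, suffice
  because bits are idempotent; a monomial added twice cancels.\<close>

inductive_set bool_poly :: "'i set \<Rightarrow> nat \<Rightarrow> (('i \<Rightarrow> bit) \<Rightarrow> bit) set"
  for I :: "'i set" and d :: nat where
  zero: "(\<lambda>_. 0) \<in> bool_poly I d"
| add_monomial: "f \<in> bool_poly I d \<Longrightarrow> finite T \<Longrightarrow> T \<subseteq> I \<Longrightarrow> card T \<le> d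
    \<Longrightarrow> (\<lambda>z. f z + (\<Prod>i\<in>T. z i)) \<in> bool_poly I d"

lemma bool_poly_monomial:
  assumes "finite T" "T \<subseteq> I" "card T \<le> d"
  shows "(\<lambda>z. \<Prod>i\<in>T. z i) \<in> bool_poly I d"
  using bool_poly.add_monomial[OF bool_poly.zero assms] by simp

lemma bool_poly_const: "(\<lambda>_. a) \<in> bool_poly I d"
  using bool_poly.zero[of I d] bool_poly_monomial[of "{}" I d] by (cases a) auto

lemma bool_poly_var: "i \<in> I \<Longrightarrow> (\<lambda>z. z i) \<in> bool_poly I (Suc d)"
  using bool_poly_monomial[of "{i}" I "Suc d"] by simp

lemma bool_poly_add:
  assumes "f \<in> bool_poly I d" "g \<in> bool_poly I d"
  shows "(\<lambda>z. f z + g z) \<in> bool_poly I d"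
  using assms(2)
proof induction
  case (add_monomial g T)
  then show ?case
    using bool_poly.add_monomial[of "\<lambda>z. f z + g z"] by (simp add: add.assoc)
qed (simp add: assms(1))

lemma bool_poly_sum:
  assumes "\<And>j. j \<in> A \<Longrightarrow> f j \<in> bool_poly I d"
  shows "(\<lambda>z. \<Sum>j\<in>A. f j z) \<in> bool_poly I d"
  using assms
proof (induction A rule: infinite_finite_induct)
  case (insert j A)
  then have "(\<lambda>z. f j z + (\<Sum>i\<in>A. f i z)) \<in> bool_poly I d"
    by (intro bool_poly_add) auto
  then show ?case using insert.hyps by simp
qed (simp_all add: bool_poly.zero)

lemma bool_poly_mono:
  assumes "f \<in> bool_poly I d" "I \<subseteq> J" "d \<le> e"
  shows "f \<in> bool_poly J e"
  using assms(1)
proof induction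
  case (add_monomial f T)
  show ?case
    by (rule bool_poly.add_monomial) (use add_monomial assms(2,3) in auto)
qed (rule bool_poly.zero)

text \<open>A squarefree monomial has no more factors than there are variables. This later caps the
  degree of high powers.\<close>

lemma bool_poly_degree_le_card:
  assumes "f \<in> bool_poly I d" "finite I"
  shows "f \<in> bool_poly I (card I)"
  using assms(1)
proof induction
  case (add_monomial f T)
  show ?case
    by (rule bool_poly.add_monomial) (use add_monomial assms(2) in \<open>auto intro: card_mono\<close>)
qed (rule bool_poly.zero)

lemma prod_bit:
  fixes f :: "'i \<Rightarrow> bit"
  assumes "finite A"
  shows "(\<Prod>i\<in>A. f i) = (if \<forall>i\<in>A. f i = 1 then 1 else 0)"
  using assms by induction auto

lemma monomial_mult:
  fixes z :: "'i \<Rightarrow> bit"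
  assumes "finite S" "finite T"
  shows "(\<Prod>i\<in>S. z i) * (\<Prod>i\<in>T. z i) = (\<Prod>i\<in>S \<union> T. z i)"
  using assms by (auto simp: prod_bit)

lemma bool_poly_mult:
  assumes "f \<in> bool_poly I d" "g \<in> bool_poly I e"
  shows "(\<lambda>z. f z * g z) \<in> bool_poly I (d + e)"
  using assms(2)
proof induction
  case (add_monomial g T)
  have "(\<lambda>z. f z * (\<Prod>i\<in>T. z i)) \<in> bool_poly I (d + e)"
    using assms(1)
  proof induction
    case (add_monomial f S)
    have "card (S \<union> T) \<le> d + e"
      using card_Un_le[of S T] \<open>card S \<le> d\<close> \<open>card T \<le> e\<close> by linarith
    then show ?case
      using add_monomial \<open>finite T\<close> \<open>T \<subseteq> I\<close>
      by (simp add: distrib_right monomial_mult bool_poly.add_monomial)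
  qed (simp add: bool_poly.zero)
  with add_monomial.IH show ?case
    by (simp add: distrib_left bool_poly_add)
qed (simp add: bool_poly.zero)

lemma bool_poly_prod:
  assumes "finite A" "\<And>j. j \<in> A \<Longrightarrow> f j \<in> bool_poly I (d j)"
  shows "(\<lambda>z. \<Prod>j\<in>A. f j z) \<in> bool_poly I (\<Sum>j\<in>A. d j)"
  using assms
proof induction
  case (insert j A)
  then have "(\<lambda>z. f j z * (\<Prod>i\<in>A. f i z)) \<in> bool_poly I (d j + (\<Sum>i\<in>A. d i))"
    by (intro bool_poly_mult) auto
  then show ?case using insert.hyps by simp
qed (simp add: bool_poly_const)

text \<open>Renames variables. It is used with \<open>Inl\<close> to regard a polynomial in the
  coordinates of \<open>u\<close> as one in those of \<open>(u, v)\<close>.\<close>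

lemma bool_poly_reindex:
  fixes \<pi> :: "'a \<Rightarrow> 'b"
  assumes "f \<in> bool_poly I d" "inj_on \<pi> I"
  shows "(\<lambda>z. f (z \<circ> \<pi>)) \<in> bool_poly (\<pi> ` I) d"
  using assms(1)
proof induction
  case (add_monomial f T)
  have "inj_on \<pi> T" using add_monomial assms(2) inj_on_subset by blast
  then have "(\<Prod>i\<in>\<pi> ` T. z i) = (\<Prod>i\<in>T. z (\<pi> i))" for z :: "'b \<Rightarrow> bit"
    by (simp add: prod.reindex)
  moreover have "card (\<pi> ` T) \<le> d"
    using card_image_le[OF \<open>finite T\<close>, of \<pi>] \<open>card T \<le> d\<close> by linarith
  ultimately show ?case
    using bool_poly.add_monomial[OF add_monomial.IH, of "\<pi> ` T"] add_monomial.hyps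
    by (simp add: image_mono)
qed (rule bool_poly.zero)

text \<open>The Croot--Lev--Pach splitting: one of the two factors of each monomial of
  \<^term>\<open>f (x + y)\<close> has degree at most \<^term>\<open>d div 2\<close>.\<close>

lemma bool_poly_translate_split:
  fixes I :: "'i set"
  assumes "f \<in> bool_poly I d" "finite I"
  defines "L \<equiv> {T. T \<subseteq> I \<and> card T \<le> d div 2}"
  shows "\<exists>g h. \<forall>x y. f (\<lambda>i. x i + y i)
    = (\<Sum>T\<in>L. (\<Prod>i\<in>T. x i) * g T y) + (\<Sum>T\<in>L. h T x * (\<Prod>i\<in>T. y i))"
  using assms(1)
proof induction
  case zero
  show ?case by (rule exI[of _ "\<lambda>_ _. 0"], rule exI[of _ "\<lambda>_ _. 0"]) simp
next
  case (add_monomial f T)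
  have fL: "finite L" using assms(2) by (auto simp: L_def)
  obtain g h where gh: "\<And>x y. f (\<lambda>i. x i + y i)
    = (\<Sum>T\<in>L. (\<Prod>i\<in>T. x i) * g T y) + (\<Sum>T\<in>L. h T x * (\<Prod>i\<in>T. y i))"
    using add_monomial.IH by blast
  \<comment> \<open>\<open>P\<close> indexes the terms of the expanded monomial with a small
    \<open>x\<close>-part. \<open>Q\<close> indexes the rest by their \<open>y\<close>-part;
    requiring \<open>T - S \<notin> L\<close> keeps terms with two small parts from being counted
    twice.\<close>
  define P where "P = {S \<in> Pow T. S \<in> L}"
  define Q where "Q = {S \<in> L. S \<subseteq> T \<and> T - S \<notin> L}"
  define g' where "g' = (\<lambda>S y. g S y + (if S \<in> P then \<Prod>i\<in>T - S. y i else 0))"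
  define h' where "h' = (\<lambda>S x. h S x + (if S \<in> Q then \<Prod>i\<in>T - S. x i else 0))"
  have "f (\<lambda>i. x i + y i) + (\<Prod>i\<in>T. x i + y i)
    = (\<Sum>T\<in>L. (\<Prod>i\<in>T. x i) * g' T y) + (\<Sum>T\<in>L. h' T x * (\<Prod>i\<in>T. y i))" for x y
  proof -
    let ?t = "\<lambda>S. (\<Prod>i\<in>S. x i) * (\<Prod>i\<in>T - S. y i)"
    \<comment> \<open>If \<open>S\<close> has at least \<open>d div 2 + 1\<close> elements, at most
      \<open>d - d div 2 - 1\<close> remain, which is at most \<open>d div 2\<close> for either
      parity of \<open>d\<close>.\<close>
    have small: "T - S \<in> L" if "S \<subseteq> T" "S \<notin> L" for S
    proof -
      have "card S + card (T - S) = card T"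
        using \<open>finite T\<close> that by (metis card_Diff_subset card_mono finite_subset le_add_diff_inverse)
      moreover have "card S > d div 2"
        using that add_monomial.hyps by (auto simp: L_def)
      ultimately show ?thesis
        using add_monomial.hyps by (auto simp: L_def)
    qed
    have "(\<Prod>i\<in>T. x i + y i) = (\<Sum>S\<in>Pow T. ?t S)"
      using prod_add[OF \<open>finite T\<close>] .
    also have "\<dots> = (\<Sum>S\<in>P. ?t S) + (\<Sum>S\<in>Pow T - P. ?t S)"
      using \<open>finite T\<close> by (subst sum.subset_diff[of P]) (auto simp: P_def add.commute)
    also have "(\<Sum>S\<in>Pow T - P. ?t S) = (\<Sum>S\<in>Q. (\<Prod>i\<in>T - S. x i) * (\<Prod>i\<in>S. y i))"
      by (rule sum.reindex_bij_witness[where i = "\<lambda>S. T - S" and j = "\<lambda>S. T - S"])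
        (auto simp: P_def Q_def double_diff intro: small)
    also have "(\<Sum>S\<in>P. ?t S) = (\<Sum>S\<in>L. (\<Prod>i\<in>S. x i) * (if S \<in> P then \<Prod>i\<in>T - S. y i else 0))"
      using fL by (intro sum.mono_neutral_cong_left) (auto simp: P_def)
    also have "(\<Sum>S\<in>Q. (\<Prod>i\<in>T - S. x i) * (\<Prod>i\<in>S. y i))
        = (\<Sum>S\<in>L. (if S \<in> Q then \<Prod>i\<in>T - S. x i else 0) * (\<Prod>i\<in>S. y i))"
      using fL by (intro sum.mono_neutral_cong_left) (auto simp: Q_def)
    finally show ?thesis
      by (simp add: gh g'_def h'_def distrib_left distrib_right sum.distrib ac_simps)
  qed
  then show ?case
    by (intro exI[of _ g'] exI[of _ h'] allI)
qed

section \<open>Counting small subsets\<close>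

text \<open>For a uniformly random \<open>T\<close>, \<open>card I - 2 * card T\<close> is a sum of
  \<open>card I\<close> independent signs, so its mean square is \<open>card I\<close>. The
  induction splits on \<open>x \<in> T\<close> and uses (a + 1)^2 + (a - 1)^2 = 2 a^2 + 2.\<close>

lemma sum_Pow_second_moment:
  assumes "finite I"
  shows "(\<Sum>T\<in>Pow I. (real (card I) - 2 * real (card T))\<^sup>2) = real (card I) * 2 ^ card I"
  using assms
proof induction
  case (insert x I)
  let ?n = "real (card I)"
  have fT: "finite T" if "T \<in> Pow I" for T
    using that insert.hyps finite_subset by auto
  have inj: "inj_on (insert x) (Pow I)"
    using insert.hyps by (intro inj_onI) (metis PowD insert_ident subset_iff)
  have "(\<Sum>T\<in>Pow (insert x I). (real (card (insert x I)) - 2 * real (card T))\<^sup>2)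
    = (\<Sum>T\<in>Pow I. (?n + 1 - 2 * real (card T))\<^sup>2)
      + (\<Sum>T\<in>Pow I. (?n + 1 - 2 * real (card (insert x T)))\<^sup>2)"
    unfolding Pow_insert using insert.hyps
    by (subst sum.union_disjoint)
      (auto simp: sum.reindex[OF inj] add.commute)
  also have "(\<Sum>T\<in>Pow I. (?n + 1 - 2 * real (card (insert x T)))\<^sup>2)
      = (\<Sum>T\<in>Pow I. (?n - 1 - 2 * real (card T))\<^sup>2)"
  proof (rule sum.cong[OF refl])
    fix T assume "T \<in> Pow I"
    then have "card (insert x T) = Suc (card T)"
      using insert.hyps(2) fT[of T] by (subst card_insert_disjoint) auto
    then show "(?n + 1 - 2 * real (card (insert x T)))\<^sup>2 = (?n - 1 - 2 * real (card T))\<^sup>2"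
      by (simp add: algebra_simps)
  qed
  also have "(\<Sum>T\<in>Pow I. (?n + 1 - 2 * real (card T))\<^sup>2) + (\<Sum>T\<in>Pow I. (?n - 1 - 2 * real (card T))\<^sup>2)
    = (\<Sum>T\<in>Pow I. 2 * (?n - 2 * real (card T))\<^sup>2 + 2)"
    unfolding sum.distrib[symmetric] by (intro sum.cong) (simp_all add: power2_eq_square algebra_simps)
  also have "\<dots> = 2 * (?n * 2 ^ card I) + 2 * 2 ^ card I"
    using insert by (simp add: sum.distrib sum_distrib_left[symmetric] card_Pow)
  finally show ?case using insert.hyps by (simp add: algebra_simps)
qed simp

text \<open>Chebyshev's inequality: each counted \<open>T\<close> contributes at least
  \<open>t^2\<close> to the second moment.\<close>

lemma card_small_subsets_le:
  assumes "finite I" and k: "2 * real k \<le> real (card I) - t" and "0 \<le> t"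
  shows "real (card {T. T \<subseteq> I \<and> card T \<le> k}) * t\<^sup>2 \<le> real (card I) * 2 ^ card I"
proof -
  let ?L = "{T. T \<subseteq> I \<and> card T \<le> k}"
  have "real (card ?L) * t\<^sup>2 = (\<Sum>T\<in>?L. t\<^sup>2)" by simp
  also have "\<dots> \<le> (\<Sum>T\<in>?L. (real (card I) - 2 * real (card T))\<^sup>2)"
    using k \<open>0 \<le> t\<close> by (intro sum_mono power_mono) auto
  also have "\<dots> \<le> (\<Sum>T\<in>Pow I. (real (card I) - 2 * real (card T))\<^sup>2)"
    using assms(1) by (intro sum_mono2) auto
  finally show ?thesis by (simp add: sum_Pow_second_moment assms(1))
qed


section \<open>Coordinates on a field with \<open>2\<^sup>m\<close> elements\<close>

text \<open>The F_2-linear combination of \<open>b 0\<close>, ..., \<open>b (k - 1)\<close> with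
  coefficients \<open>z\<close>. Choosing between \<open>b k\<close> and zero avoids a scalar
  multiplication on \<open>K\<close>.\<close>

primrec binary_comb ::
    "('a, 'c) ring_scheme \<Rightarrow> (nat \<Rightarrow> 'a) \<Rightarrow> nat \<Rightarrow> (nat \<Rightarrow> bit) \<Rightarrow> 'a" where
  "binary_comb K b 0 z = \<zero>\<^bsub>K\<^esub>"
| "binary_comb K b (Suc k) z = binary_comb K b k z \<oplus>\<^bsub>K\<^esub> (if z k = 1 then b k else \<zero>\<^bsub>K\<^esub>)"

lemma binary_comb_cong:
  assumes "\<And>i. i < k \<Longrightarrow> b i = b' i" "\<And>i. i < k \<Longrightarrow> z i = z' i"
  shows "binary_comb K b k z = binary_comb K b' k z'"
  using assms by (induction k) auto

definition bit_additive :: "('a, 'c) ring_scheme \<Rightarrow> ('a \<Rightarrow> bit) \<Rightarrow> bool" where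
  "bit_additive K \<phi> \<longleftrightarrow>
     (\<forall>x\<in>carrier K. \<forall>y\<in>carrier K. \<phi> (x \<oplus>\<^bsub>K\<^esub> y) = \<phi> x + \<phi> y)"

context abelian_group
begin

lemma binary_comb_closed:
  "(\<And>i. b i \<in> carrier G) \<Longrightarrow> binary_comb G b k z \<in> carrier G"
  by (induction k) auto

lemma binary_comb_zero: "binary_comb G b k (\<lambda>_. 0) = \<zero>"
  by (induction k) auto

lemma bit_additive_zero:
  assumes "bit_additive G \<phi>"
  shows "\<phi> \<zero> = 0"
proof -
  have "\<phi> (\<zero> \<oplus> \<zero>) = \<phi> \<zero> + \<phi> \<zero>"
    using assms unfolding bit_additive_def by blast
  then show ?thesis by simp
qed

lemma bit_additive_binary_comb:
  assumes l: "bit_additive G \<phi>" and b: "\<And>i. b i \<in> carrier G"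
  shows "\<phi> (binary_comb G b k z) = (\<Sum>i<k. z i * \<phi> (b i))"
proof (induction k)
  case (Suc k)
  have "\<phi> (binary_comb G b (Suc k) z)
      = \<phi> (binary_comb G b k z) + \<phi> (if z k = 1 then b k else \<zero>)"
    using l binary_comb_closed[OF b] b unfolding bit_additive_def by simp
  also have "\<phi> (if z k = 1 then b k else \<zero>) = z k * \<phi> (b k)"
    by (simp add: bit_additive_zero[OF l])
  finally show ?case by (simp add: Suc.IH)
qed (simp add: bit_additive_zero[OF l])

context
  assumes exponent_two: "\<And>x. x \<in> carrier G \<Longrightarrow> x \<oplus> x = \<zero>"
begin

lemma minus_eq_self: "x \<in> carrier G \<Longrightarrow> \<ominus> x = x"
  using exponent_two minus_equality by blast

lemma binary_comb_add:
  assumes b: "\<And>i. b i \<in> carrier G"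
  shows "binary_comb G b k (\<lambda>i. z i + z' i) = binary_comb G b k z \<oplus> binary_comb G b k z'"
proof (induction k)
  case (Suc k)
  have *: "(if z k + z' k = 1 then b k else \<zero>)
      = (if z k = 1 then b k else \<zero>) \<oplus> (if z' k = 1 then b k else \<zero>)"
    using b exponent_two[OF b] by (cases "z k"; cases "z' k") simp_all
  show ?case
    using binary_comb_closed[OF b] b by (simp only: binary_comb.simps Suc.IH *) (simp add: a_ac)
qed simp

text \<open>Greedy choice of a basis: for \<open>k < m\<close> the \<open>2 ^ k\<close> combinations
  found so far miss some \<open>w\<close>, which becomes the next basis element. At
  \<open>k = m\<close>, counting turns injectivity into bijectivity.\<close>

lemma exists_binary_basis:
  assumes fin: "finite (carrier G)" and card: "card (carrier G) = 2 ^ m"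
  shows "\<exists>b. (\<forall>i. b i \<in> carrier G) \<and> bij_betw (binary_comb G b m) (words {..<m}) (carrier G)"
proof -
  have "\<exists>b. (\<forall>i. b i \<in> carrier G) \<and> inj_on (binary_comb G b k) (words {..<k})" if "k \<le> m" for k
    using that
  proof (induction k)
    case 0
    show ?case
      \<comment> \<open>Entries of \<open>b\<close> from \<open>k\<close> on are placeholders; zero
        keeps them in the carrier.\<close>
      by (rule exI[of _ "\<lambda>_. \<zero>"]) (auto simp: words_def inj_on_def fun_eq_iff)
  next
    case (Suc k)
    then obtain b where b: "\<And>i. b i \<in> carrier G" and inj: "inj_on (binary_comb G b k) (words {..<k})"
      by auto
    let ?A = "binary_comb G b k ` words {..<k}"
    have "card ?A = 2 ^ k"
      using card_image[OF inj] by (simp add: card_words)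
    also have "\<dots> < card (carrier G)"
      using Suc.prems by (simp add: card)
    finally have "?A \<noteq> carrier G" by auto
    moreover have "?A \<subseteq> carrier G"
      using binary_comb_closed[OF b] by auto
    ultimately obtain w where w: "w \<in> carrier G" "w \<notin> ?A" by blast
    define b' where "b' = b(k := w)"
    have b': "b' i \<in> carrier G" for i using b w by (simp add: b'_def)
    have b'k: "b' k = w" by (simp add: b'_def)
    define cut where "cut = (\<lambda>z :: nat \<Rightarrow> bit. z(k := 0))"
    have cut: "cut z \<in> words {..<k}" if "z \<in> words {..<Suc k}" for z
      using that by (auto simp: cut_def words_def less_Suc_eq)
    have comb: "binary_comb G b' k z = binary_comb G b k (cut z)" for z
      by (rule binary_comb_cong) (auto simp: b'_def cut_def)
    \<comment> \<open>A coefficient 1 at \<open>k\<close> would put \<open>w = \<ominus> w\<close>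
      into \<open>?A\<close>. Otherwise only the old basis is involved and \<open>inj\<close>
      applies to \<open>cut z\<close>.\<close>
    have kernel: "z = (\<lambda>_. 0)" if z: "z \<in> words {..<Suc k}" and "binary_comb G b' (Suc k) z = \<zero>" for z
    proof -
      have eq: "binary_comb G b k (cut z) \<oplus> (if z k = 1 then w else \<zero>) = \<zero>"
        using that(2) by (simp only: binary_comb.simps comb b'k)
      have zk: "z k = 0"
      proof (rule ccontr)
        assume "z k \<noteq> 0"
        then have "binary_comb G b k (cut z) = \<ominus> w"
          using eq w(1) binary_comb_closed[OF b] by (simp add: minus_equality)
        then have "w \<in> ?A"
          using cut[OF z] by (simp add: minus_eq_self w(1)) (metis imageI)
        with w(2) show False ..
      qed
      then have "binary_comb G b k (cut z) = binary_comb G b k (\<lambda>_. 0)"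
        using eq binary_comb_closed[OF b] binary_comb_zero by (simp add: zk)
      then have "cut z = (\<lambda>_. 0)"
        using inj cut[OF z] by (auto simp: inj_on_def words_def)
      then show ?thesis
        using zk by (auto simp: cut_def fun_eq_iff split: if_splits)
    qed
    have "inj_on (binary_comb G b' (Suc k)) (words {..<Suc k})"
    proof (rule inj_onI)
      fix z z' assume z: "z \<in> words {..<Suc k}" "z' \<in> words {..<Suc k}"
        and eq: "binary_comb G b' (Suc k) z = binary_comb G b' (Suc k) z'"
      \<comment> \<open>Sum and difference agree in exponent two, so the sum of two words with equal
        images lies in the kernel.\<close>
      have "binary_comb G b' (Suc k) (\<lambda>i. z i + z' i) = \<zero>"
        using binary_comb_add[where b = b' and k = "Suc k" and z = z and z' = z', OF b']
          exponent_two[OF binary_comb_closed[OF b']]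
        by (simp only: eq)
      moreover have "(\<lambda>i. z i + z' i) \<in> words {..<Suc k}"
        using z by (auto simp: words_def)
      ultimately have "z i + z' i = 0" for i
        using kernel by (metis (no_types))
      then have "z i + z' i + z' i = z' i" for i by simp
      then show "z = z'" by (simp add: fun_eq_iff add.assoc)
    qed
    then show ?case using b' by blast
  qed
  then obtain b where b: "\<And>i. b i \<in> carrier G" and inj: "inj_on (binary_comb G b m) (words {..<m})"
    by blast
  have "binary_comb G b m ` words {..<m} = carrier G"
    using binary_comb_closed[OF b] card_image[OF inj]
    by (intro card_subset_eq[OF fin]) (auto simp: card_words card)
  then show ?thesis using b inj by (auto simp: bij_betw_def)
qed

end

end

text \<open>By Lagrange in the additive group, \<open>2 ^ m\<close> copies of \<open>\<one>\<close>
  sum to zero. This sum is the \<open>m\<close>-th power of \<open>\<one> \<oplus> \<one>\<close>,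
  which therefore vanishes in a field.\<close>

lemma (in field) exponent_two:
  assumes "order R = 2 ^ m" "x \<in> carrier R"
  shows "x \<oplus> x = \<zero>"
proof -
  have pow: "[(2 ^ k :: nat)] \<cdot> \<one> = (\<one> \<oplus> \<one>) [^] k" for k
  proof (induction k)
    case (Suc k)
    have "[(2 ^ Suc k :: nat)] \<cdot> \<one> = [(2 ^ k :: nat)] \<cdot> \<one> \<oplus> [(2 ^ k :: nat)] \<cdot> \<one>"
      by (simp add: add.nat_pow_mult mult_2)
    also have "\<dots> = (\<one> \<oplus> \<one>) [^] k \<otimes> (\<one> \<oplus> \<one>)"
      by (simp add: Suc.IH r_distr)
    finally show ?case by simp
  qed simp
  have "finite (carrier R)"
    using assms(1) by (intro card_ge_0_finite) (simp add: order_def)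
  then have "[order R] \<cdot> \<one> = \<zero>"
    using comm_group.power_order_eq_one[OF a_comm_group, of \<one>]
    by (simp add: add_pow_def order_def)
  then have "(\<one> \<oplus> \<one>) [^] m = \<zero>"
    using assms(1) by (simp add: pow)
  moreover have "(\<one> \<oplus> \<one>) [^] k \<noteq> \<zero>" if "\<one> \<oplus> \<one> \<noteq> \<zero>" for k :: nat
    using that by (induction k) (simp_all add: integral_iff)
  ultimately have "\<one> \<oplus> \<one> = \<zero>"
    by blast
  then have "(\<one> \<oplus> \<one>) \<otimes> x = \<zero>"
    using assms(2) by simp
  then show ?thesis
    using assms(2) by (simp add: l_distr)
qed

text \<open>Splitting off one factor at a time: for fixed \<open>y\<close> the map
  \<open>u \<mapsto> \<phi> (y \<otimes> u)\<close> is additive, hence linear in the coordinates of \<open>u\<close>.\<close>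

lemma (in cring) bool_poly_power:
  assumes b: "\<And>i. b i \<in> carrier R" and "bit_additive R \<phi>"
  shows "(\<lambda>z. \<phi> (binary_comb R b m z [^] n)) \<in> bool_poly {..<m} n"
  using assms(2)
proof (induction n arbitrary: \<phi>)
  case 0
  show ?case by (simp add: bool_poly_const)
next
  case (Suc n)
  let ?u = "binary_comb R b m"
  have u: "?u z \<in> carrier R" for z by (rule binary_comb_closed[OF b])
  have left: "bit_additive R (\<lambda>x. \<phi> (y \<otimes> x))" if "y \<in> carrier R" for y
    using Suc.prems that unfolding bit_additive_def by (simp add: r_distr)
  \<comment> \<open>With \<open>y = b i\<close> this is a new functional for the induction
    hypothesis, which is why \<open>\<phi>\<close> is generalised.\<close>
  have right: "bit_additive R (\<lambda>x. \<phi> (x \<otimes> y))" if "y \<in> carrier R" for y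
    using Suc.prems that unfolding bit_additive_def by (simp add: l_distr)
  have "\<phi> (?u z [^] Suc n) = (\<Sum>i<m. z i * \<phi> (?u z [^] n \<otimes> b i))" for z
    using bit_additive_binary_comb[where b = b and k = m and z = z, OF left[of "?u z [^] n"] b] u
    by simp
  moreover have "(\<lambda>z. \<Sum>i<m. z i * \<phi> (?u z [^] n \<otimes> b i)) \<in> bool_poly {..<m} (Suc n)"
  proof (rule bool_poly_sum)
    fix i assume "i \<in> {..<m}"
    then have "(\<lambda>z. z i * \<phi> (?u z [^] n \<otimes> b i)) \<in> bool_poly {..<m} (Suc 0 + n)"
      by (intro bool_poly_mult bool_poly_var Suc.IH[OF right[OF b]])
    then show "(\<lambda>z. z i * \<phi> (?u z [^] n \<otimes> b i)) \<in> bool_poly {..<m} (Suc n)" by simp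
  qed
  ultimately show ?case by presburger
qed


section \<open>The indicator of the curve\<close>

text \<open>Here \<open>t\<close> is the number of factors taken from the power. If
  \<open>t * n \<le> m\<close>, then m + (n - 1) t is at most 2m - m/n; otherwise
  \<open>t > m/n\<close> and 2m - t is below it. The substitutions remove natural subtraction, and
  \<open>n' * t \<le> s\<close> restates \<open>t * n \<le> m\<close>.\<close>

lemma split_degree_bound:
  fixes n m t :: nat
  assumes "t \<le> m" "0 < n"
  shows "min (t * n) m + (m - t) \<le> (2 * n - 1) * m div n"
proof -
  obtain n' where n: "n = Suc n'" using assms(2) gr0_implies_Suc by blast
  obtain s where m: "m = t + s" using assms(1) le_Suc_ex by blast
  have "(min (t * n) m + (m - t)) * n \<le> (2 * n - 1) * m"
  proof (cases "n' * t \<le> s")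
    case True
    then have "n' * (n' * t) \<le> n' * s" by simp
    with True show ?thesis by (simp add: n m min_def algebra_simps)
  next
    case False
    then show ?thesis by (simp add: n m min_def algebra_simps)
  qed
  then show ?thesis
    using assms(2) by (simp add: less_eq_div_iff_mult_less_eq)
qed

locale binary_coordinates = cring R for R (structure) +
  fixes m :: nat and b :: "nat \<Rightarrow> 'a"
  assumes exponent_two: "\<And>x. x \<in> carrier R \<Longrightarrow> x \<oplus> x = \<zero>"
    and b_closed: "\<And>i. b i \<in> carrier R"
    and bij: "bij_betw (binary_comb R b m) (words {..<m}) (carrier R)"
begin

abbreviation comb :: "(nat \<Rightarrow> bit) \<Rightarrow> 'a" where
  "comb \<equiv> binary_comb R b m"

abbreviation coord :: "'a \<Rightarrow> nat \<Rightarrow> bit" where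
  "coord \<equiv> inv_into (words {..<m}) comb"

lemma comb_add: "comb (\<lambda>i. z i + z' i) = comb z \<oplus> comb z'"
  by (rule binary_comb_add[OF exponent_two b_closed])

lemma comb_coord: "x \<in> carrier R \<Longrightarrow> comb (coord x) = x"
  using bij bij_betw_inv_into_right by metis

lemma coord_comb_words: "z \<in> words {..<m} \<Longrightarrow> coord (comb z) = z"
  using bij bij_betw_inv_into_left by metis

text \<open>\<open>comb\<close> ignores the positions from \<open>m\<close> on, so an arbitrary
  \<open>z\<close> can be truncated to a word without changing its image.\<close>

lemma coord_comb:
  assumes "k < m"
  shows "coord (comb z) k = z k"
proof -
  let ?z = "\<lambda>i. if i < m then z i else 0"
  have "comb z = comb ?z" by (rule binary_comb_cong) auto
  moreover have "?z \<in> words {..<m}" by (simp add: words_def)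
  ultimately show ?thesis using assms coord_comb_words[of ?z] by simp
qed

lemma eq_iff_coord:
  assumes "x \<in> carrier R" "y \<in> carrier R"
  shows "x = y \<longleftrightarrow> (\<forall>k<m. coord x k = coord y k)"
proof
  assume "\<forall>k<m. coord x k = coord y k"
  then have "comb (coord x) = comb (coord y)" by (intro binary_comb_cong) auto
  then show "x = y" using assms by (simp add: comb_coord)
qed simp

lemma bit_additive_coord:
  assumes "k < m"
  shows "bit_additive R (\<lambda>x. coord x k)"
  unfolding bit_additive_def
proof (intro ballI)
  fix x y assume xy: "x \<in> carrier R" "y \<in> carrier R"
  have "x \<oplus> y = comb (\<lambda>i. coord x i + coord y i)"
    using xy by (simp add: comb_add comb_coord)
  then show "coord (x \<oplus> y) k = coord x k + coord y k"
    using assms by (simp add: coord_comb)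
qed

text \<open>In the expansion of \<open>\<Prod>\<^sub>k (1 + v\<^sub>k + (u\<^sup>n)\<^sub>k)\<close> the factors \<open>(u\<^sup>n)\<^sub>k\<close> with
  \<open>k \<in> T\<close> contribute degree at most \<open>min (n * card T) m\<close>, as they involve only the \<open>m\<close>
  coordinates of \<open>u\<close>. This saves \<open>m / n\<close> on the trivial bound \<open>2 * m\<close>.\<close>

lemma power_curve_bool_poly:
  assumes "0 < n"
  shows "(\<lambda>z. if (comb (z \<circ> Inl), comb (z \<circ> Inr)) \<in> power_curve n R then 1 else 0)
    \<in> bool_poly ({..<m} <+> {..<m}) ((2 * n - 1) * m div n)"
proof -
  define I where "I = {..<m} <+> {..<m}"
  \<comment> \<open>The \<open>Inl\<close> variables are the coordinates of \<open>u\<close>, the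
    \<open>Inr\<close> variables those of \<open>v\<close>.\<close>
  define g where "g = (\<lambda>k (z :: nat + nat \<Rightarrow> bit). coord (comb (z \<circ> Inl) [^] n) k)"
  define h where "h = (\<lambda>k (z :: nat + nat \<Rightarrow> bit). 1 + z (Inr k))"
  have closed: "comb z \<in> carrier R" for z
    by (rule binary_comb_closed[OF b_closed])
  have "(if (comb (z \<circ> Inl), comb (z \<circ> Inr)) \<in> power_curve n R then 1 else 0)
    = (\<Prod>k<m. g k z + h k z)" for z
  proof -
    have "(comb (z \<circ> Inl), comb (z \<circ> Inr)) \<in> power_curve n R
        \<longleftrightarrow> comb (z \<circ> Inr) = comb (z \<circ> Inl) [^] n"
      using closed by (auto simp: power_curve_def)
    also have "\<dots> \<longleftrightarrow> (\<forall>k<m. coord (comb (z \<circ> Inr)) k = g k z)"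
      using closed by (subst eq_iff_coord) (auto simp: g_def)
    also have "\<dots> \<longleftrightarrow> (\<forall>k<m. g k z + h k z = 1)"
    proof -
      have "a = c \<longleftrightarrow> c + (1 + a) = 1" for a c :: bit
        by (cases a; cases c) simp_all
      then show ?thesis by (simp add: coord_comb h_def)
    qed
    finally show ?thesis by (simp add: prod_bit Ball_def)
  qed
  moreover have "(\<lambda>z. \<Prod>k<m. g k z + h k z) \<in> bool_poly I ((2 * n - 1) * m div n)"
  proof -
    \<comment> \<open>Degrees are bounded term by term after expansion; adding the degrees of the
      unexpanded factors would only give \<open>n * m\<close>.\<close>
    have "(\<lambda>z. \<Sum>T\<in>Pow {..<m}. (\<Prod>k\<in>T. g k z) * (\<Prod>k\<in>{..<m} - T. h k z))
      \<in> bool_poly I ((2 * n - 1) * m div n)"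
    proof (rule bool_poly_sum)
      fix T assume "T \<in> Pow {..<m}"
      then have T: "T \<subseteq> {..<m}" "finite T" "card T \<le> m"
        using finite_subset card_mono[of "{..<m}" T] by auto
      have "(\<lambda>z. \<Prod>k\<in>T. coord (comb z [^] n) k) \<in> bool_poly {..<m} (\<Sum>k\<in>T. n)"
        using T by (intro bool_poly_prod bool_poly_power b_closed bit_additive_coord) auto
      then have "(\<lambda>z. \<Prod>k\<in>T. coord (comb z [^] n) k) \<in> bool_poly {..<m} (min (card T * n) m)"
        using bool_poly_degree_le_card[of _ "{..<m}"] by (auto simp: min_def)
      then have "(\<lambda>z. \<Prod>k\<in>T. g k z) \<in> bool_poly (Inl ` {..<m}) (min (card T * n) m)"
        unfolding g_def by (rule bool_poly_reindex) simp
      then have g: "(\<lambda>z. \<Prod>k\<in>T. g k z) \<in> bool_poly I (min (card T * n) m)"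
        by (rule bool_poly_mono) (auto simp: I_def)
      have "(\<lambda>z. \<Prod>k\<in>{..<m} - T. h k z) \<in> bool_poly I (\<Sum>k\<in>{..<m} - T. Suc 0)"
        unfolding h_def
        by (intro bool_poly_prod bool_poly_add bool_poly_const bool_poly_var) (auto simp: I_def)
      then have "(\<lambda>z. \<Prod>k\<in>{..<m} - T. h k z) \<in> bool_poly I (m - card T)"
        using T by (simp add: card_Diff_subset)
      from bool_poly_mult[OF g this]
      show "(\<lambda>z. (\<Prod>k\<in>T. g k z) * (\<Prod>k\<in>{..<m} - T. h k z))
          \<in> bool_poly I ((2 * n - 1) * m div n)"
        by (rule bool_poly_mono) (use split_degree_bound T(3) assms in auto)
    qed
    then show ?thesis by (simp only: prod_add[OF finite_lessThan])
  qed
  ultimately show ?thesis unfolding I_def by presburger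
qed

end

lemma (in field) exists_binary_coordinates:
  assumes "order R = 2 ^ m"
  shows "\<exists>b. binary_coordinates R m b"
proof -
  have "finite (carrier R)"
    using assms by (intro card_ge_0_finite) (simp add: order_def)
  then obtain b where "\<And>i. b i \<in> carrier R"
      "bij_betw (binary_comb R b m) (words {..<m}) (carrier R)"
    using exists_binary_basis[OF exponent_two[OF assms]] assms unfolding order_def by blast
  then have "binary_coordinates R m b"
    using exponent_two[OF assms] by unfold_locales auto
  then show ?thesis by (rule exI[of _ b])
qed

section \<open>The rate of generalized BCH codes\<close>

lemma (in abelian_group) plane_diff:
  assumes "x \<in> carrier (plane G)" "y \<in> carrier (plane G)"
  shows "x \<otimes>\<^bsub>plane G\<^esub> inv\<^bsub>plane G\<^esub> y = (fst x \<ominus> fst y, snd x \<ominus> snd y)"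
  using assms inv_DirProd[OF a_group a_group]
  by (auto simp: DirProd_def a_minus_def a_inv_def split: prod.splits)

text \<open>The connection set omits the origin, which lies on the curve as \<open>n > 0\<close>.
  Adding the identity matrix restores it, leaving the indicator of the whole curve at the
  difference.\<close>

lemma gen_BCH_code_eq:
  fixes K :: "('a, 'c) ring_scheme"
  assumes "cring K" "0 < n"
  shows "gen_BCH_code n K = parity_check_code (carrier K \<times> carrier K) (carrier K \<times> carrier K)
    (\<lambda>x y. if (fst x \<ominus>\<^bsub>K\<^esub> fst y, snd x \<ominus>\<^bsub>K\<^esub> snd y) \<in> power_curve n K then 1 else 0)"
    (is "_ = parity_check_code ?V ?V ?H")
proof -
  interpret cring K by fact
  have V: "carrier (plane K) = ?V" by (simp add: DirProd_def)
  have H: "adjacency_matrix (gen_BCH_graph n K) x y + identity_matrix x y = ?H x y"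
    if "x \<in> ?V" "y \<in> ?V" for x y
  proof -
    have "\<zero>\<^bsub>K\<^esub> [^]\<^bsub>K\<^esub> n = \<zero>\<^bsub>K\<^esub>"
      using assms(2) by (rule nat_pow_zero[OF gr_implies_not0])
    then have zero: "(\<zero>\<^bsub>K\<^esub>, \<zero>\<^bsub>K\<^esub>) \<in> power_curve n K"
      by (force simp: power_curve_def)
    have "x = y \<longleftrightarrow> (fst x \<ominus>\<^bsub>K\<^esub> fst y, snd x \<ominus>\<^bsub>K\<^esub> snd y) = (\<zero>\<^bsub>K\<^esub>, \<zero>\<^bsub>K\<^esub>)"
      using that by (auto simp: prod_eq_iff)
    moreover have "x \<otimes>\<^bsub>plane K\<^esub> inv\<^bsub>plane K\<^esub> y = (fst x \<ominus>\<^bsub>K\<^esub> fst y, snd x \<ominus>\<^bsub>K\<^esub> snd y)"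
      using that by (intro plane_diff) (simp_all only: V)
    ultimately show ?thesis
      using that zero
      by (auto simp: adjacency_matrix_def identity_matrix_def gen_BCH_graph_def cayley_graph_def V)
  qed
  have "(\<Sum>v\<in>?V. (adjacency_matrix (gen_BCH_graph n K) r v + identity_matrix r v) * c v)
      = (\<Sum>v\<in>?V. ?H r v * c v)" if "r \<in> ?V" for r c
    by (rule sum.cong[OF refl]) (simp only: H[OF that])
  moreover have "pverts (gen_BCH_graph n K) = ?V"
    by (simp add: gen_BCH_graph_def cayley_graph_def V)
  ultimately show ?thesis
    unfolding gen_BCH_code_def Let_def parity_check_code_def by (simp only: cong: ball_cong)
qed

text \<open>The codimension is at most \<open>2 * card L\<close>. Chebyshev with deviation
  \<open>t = m / n\<close> among \<open>2 * m\<close> variables bounds \<open>card L / 4 ^ m\<close>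
  by \<open>2 * n^2 / m\<close>.\<close>

lemma code_rate_gen_BCH_code:
  fixes K :: "('a, 'c) ring_scheme"
  assumes "field K" and ord: "order K = 2 ^ m" and pos: "0 < m" "0 < n"
  shows "1 - 4 * (real n)\<^sup>2 / real m \<le> code_rate (gen_BCH_code n K)"
    and "code_rate (gen_BCH_code n K) \<le> 1"
proof -
  interpret field K by fact
  obtain b where "binary_coordinates K m b"
    using exists_binary_coordinates[OF ord] ..
  then interpret binary_coordinates K m b .
  let ?V = "carrier K \<times> carrier K"
  let ?H = "\<lambda>x y. if (fst x \<ominus>\<^bsub>K\<^esub> fst y, snd x \<ominus>\<^bsub>K\<^esub> snd y) \<in> power_curve n K then 1 else 0 :: bit"
  define I where "I = {..<m} <+> {..<m}"
  define d where "d = (2 * n - 1) * m div n"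
  define L where "L = {T. T \<subseteq> I \<and> card T \<le> d div 2}"
  define f where "f = (\<lambda>z. if (comb (z \<circ> Inl), comb (z \<circ> Inr)) \<in> power_curve n K then 1 else 0 :: bit)"
  define \<zeta> where "\<zeta> = (\<lambda>x. case_sum (coord (fst x)) (coord (snd x)))"
  have code: "gen_BCH_code n K = parity_check_code ?V ?V ?H"
    using gen_BCH_code_eq[OF is_cring pos(2)] .
  have "finite (carrier K)"
    using ord by (intro card_ge_0_finite) (simp add: order_def)
  then have finV: "finite ?V" by simp
  have cardV: "card ?V = 2 ^ (2 * m)"
    using ord by (simp add: order_def power_add mult_2 card_cartesian_product)
  have finI: "finite I" and cardI: "card I = 2 * m"
    by (simp_all add: I_def card_Plus)
  have finL: "finite L" using finI by (simp add: L_def)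
  have "f \<in> bool_poly I d"
    unfolding f_def I_def d_def by (rule power_curve_bool_poly[OF pos(2)])
  from bool_poly_translate_split[OF this finI, folded L_def]
  obtain g h where gh: "\<And>z z'. f (\<lambda>i. z i + z' i)
    = (\<Sum>T\<in>L. (\<Prod>i\<in>T. z i) * g T z') + (\<Sum>T\<in>L. h T z * (\<Prod>i\<in>T. z' i))"
    by blast
  \<comment> \<open>In characteristic two the Cayley difference becomes the sum required by the
    splitting lemma.\<close>
  have minus: "x \<ominus>\<^bsub>K\<^esub> y = x \<oplus>\<^bsub>K\<^esub> y" if "y \<in> carrier K" for x y
    using minus_eq_self[OF exponent_two that] by (simp add: a_minus_def)
  \<comment> \<open>The left copy of \<open>L\<close> carries the terms with a small monomial in
    \<open>x\<close>, the right copy those with one in \<open>y\<close>.\<close>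
  have H: "?H x y = (\<Sum>T\<in>L <+> L. case_sum (\<lambda>T. \<Prod>i\<in>T. \<zeta> x i) (\<lambda>T. h T (\<zeta> x)) T
      * case_sum (\<lambda>T. g T (\<zeta> y)) (\<lambda>T. \<Prod>i\<in>T. \<zeta> y i) T)"
    if "x \<in> ?V" "y \<in> ?V" for x y
  proof -
    have "comb ((\<lambda>i. \<zeta> x i + \<zeta> y i) \<circ> Inl) = fst x \<oplus>\<^bsub>K\<^esub> fst y"
        "comb ((\<lambda>i. \<zeta> x i + \<zeta> y i) \<circ> Inr) = snd x \<oplus>\<^bsub>K\<^esub> snd y"
      using that by (auto simp: \<zeta>_def o_def comb_add comb_coord)
    then have "?H x y = f (\<lambda>i. \<zeta> x i + \<zeta> y i)"
      using that by (auto simp: f_def minus)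
    then show ?thesis
      using finL by (simp add: gh sum.Plus o_def)
  qed
  have "card ?V \<le> code_dim (parity_check_code ?V ?V ?H) + card (L <+> L)"
    using finL by (intro card_le_code_dim_parity_check_code[OF finV _ H]) auto
  then have dim: "2 ^ (2 * m) \<le> code_dim (gen_BCH_code n K) + 2 * card L"
    by (simp add: code cardV card_Plus finL)
  have "real d \<le> (2 * real n - 1) * real m / real n"
    using of_nat_div_le_of_nat[where 'a = real, of "(2 * n - 1) * m" n] pos(2)
    unfolding d_def by (simp add: of_nat_diff)
  also have "\<dots> = 2 * real m - real m / real n"
    using pos(2) by (simp add: field_simps)
  finally have "2 * real (d div 2) \<le> real (card I) - real m / real n"
    unfolding cardI using of_nat_div_le_of_nat[where 'a = real, of d 2] by simp
  from card_small_subsets_le[OF finI this, folded L_def]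
  have L: "real (card L) * (real m / real n)\<^sup>2 \<le> 2 * real m * 2 ^ (2 * m)"
    by (simp add: cardI)
  have "real (card L) = real (card L) * (real m / real n)\<^sup>2 * (real n / real m)\<^sup>2"
    using pos by (simp add: power_divide)
  also have "\<dots> \<le> 2 * real m * 2 ^ (2 * m) * (real n / real m)\<^sup>2"
    by (rule mult_right_mono[OF L]) simp
  also have "\<dots> = 2 * (real n)\<^sup>2 / real m * 2 ^ (2 * m)"
    using pos by (simp add: power_divide power2_eq_square)
  finally have "2 * real (card L) / 2 ^ (2 * m) \<le> 4 * (real n)\<^sup>2 / real m"
    by (simp add: divide_le_eq)
  moreover have "1 - 2 * real (card L) / 2 ^ (2 * m) \<le> code_rate (gen_BCH_code n K)"
  proof -
    have "real (2 ^ (2 * m)) \<le> real (code_dim (gen_BCH_code n K) + 2 * card L)"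
      using dim by (rule of_nat_mono)
    then have "(2 ^ (2 * m) - 2 * real (card L)) / 2 ^ (2 * m)
        \<le> real (code_dim (gen_BCH_code n K)) / 2 ^ (2 * m)"
      by (intro divide_right_mono) simp_all
    moreover have "code_length (gen_BCH_code n K) = 2 ^ (2 * m)"
      by (simp only: code code_length_parity_check_code cardV)
    ultimately show ?thesis by (simp add: code_rate_def diff_divide_distrib)
  qed
  ultimately show "1 - 4 * (real n)\<^sup>2 / real m \<le> code_rate (gen_BCH_code n K)"
    by linarith
  have "code_dim (gen_BCH_code n K) \<le> code_length (gen_BCH_code n K)"
    unfolding code code_length_parity_check_code by (rule code_dim_parity_check_code_le[OF finV])
  then show "code_rate (gen_BCH_code n K) \<le> 1"
    by (auto simp: code_rate_def divide_le_eq_1)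
qed

theorem unit_rate_gen_BCH_family:
  fixes K :: "nat \<Rightarrow> ('a, 'c) ring_scheme"
  assumes "\<And>m. 1 \<le> m \<Longrightarrow> field (K m)"
    and "\<And>m. 1 \<le> m \<Longrightarrow> order (K m) = 2 ^ m"
    and "0 < n"
  shows "unit_rate J (gen_BCH_family n K)"
proof -
  have "(\<lambda>m. code_rate (gen_BCH_family n K m)) \<longlonglongrightarrow> 1"
  proof (rule tendsto_sandwich)
    show "\<forall>\<^sub>F m in sequentially. 1 - 4 * (real n)\<^sup>2 / real m \<le> code_rate (gen_BCH_family n K m)"
      using eventually_ge_at_top[of 1]
      by eventually_elim (simp add: gen_BCH_family_def code_rate_gen_BCH_code(1) assms)
    show "\<forall>\<^sub>F m in sequentially. code_rate (gen_BCH_family n K m) \<le> 1"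
      using eventually_ge_at_top[of 1]
      by eventually_elim
        (simp add: gen_BCH_family_def code_rate_gen_BCH_code(2)[OF assms(1,2) _ assms(3)])
    show "(\<lambda>m. 1 - 4 * (real n)\<^sup>2 / real m) \<longlonglongrightarrow> 1"
      using tendsto_diff[OF tendsto_const lim_const_over_n[of "4 * (real n)\<^sup>2"]] by simp
  qed simp
  then show ?thesis
    \<comment> \<open>Convergence over all \<open>m\<close> passes to the finer filter restricted to
      \<open>J\<close>.\<close>
    unfolding unit_rate_def by (rule tendsto_mono[OF inf_le1])
qed

theorem corollary23:
  fixes K :: "nat \<Rightarrow> ('a, 'c) ring_scheme"
  assumes "\<And>m. 1 \<le> m \<Longrightarrow> field (K m)"
    and "\<And>m. 1 \<le> m \<Longrightarrow> order (K m) = 2 ^ m"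
  shows "unit_rate (gen_BCH_index 7) (gen_BCH_family 7 K)
    \<and> unit_rate (gen_BCH_index 11) (gen_BCH_family 11 K)
    \<and> unit_rate (gen_BCH_index 13) (gen_BCH_family 13 K)"
  using assms by (simp add: unit_rate_gen_BCH_family)

end
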